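(* Let $\alpha>0$, $\beta>0$, and let $X$ be a random variable following the unit-Gompertz distribution $UG(\alpha,\beta)$. Then $X$ has decreasing reversed hazard rate, and it has increasing expected inactivity time; that is, the function $r(x)=f(x)/F(x)$ is decreasing in $x\in(0,1)$, and the function $I(x)=E(x-X\mid X\le x)=\frac{1}{F(x)}\int_0^x F(y)\,dy$ is increasing in $x\in(0,1)$, where $f$ and $F$ are the probability density function and the cumulative distribution function of $X$.
   Context: The unit-Gompertz distribution $UG(\alpha,\beta)$ with shape parameter $\alpha>0$ and scale parameter $\beta>0$ is the distribution supported on $(0,1)$ with probability density function $$f(x)=f(x\mid\alpha,\beta)=\frac{\alpha\beta\exp\left[-\alpha\left(1/x^{\beta}-1\right)\right]}{x^{1+\beta}},\qquad x\in(0,1),$$ and cumulative distribution function $F(x)=F(x\mid\alpha,\beta)=\exp\left[-\alpha\left(1/x^{\beta}-1\right)\right]$ for $x\in(0,1)$. The reversed hazard rate (RHR) of $X$ is $r(x)=f(x)/F(x)$, and the expected inactivity time (EIT) of $X$ is $I(x)=E(x-X\mid X\le x)=\frac{1}{F(x)}\int_0^xF(y)\,dy$. *)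

theory Defs
  imports "HOL-Probability.Probability"
begin

definition unit_gompertz_density :: "real \<Rightarrow> real \<Rightarrow> real \<Rightarrow> real" where
  "unit_gompertz_density \<alpha> \<beta> x =
     (if 0 < x \<and> x < 1
      then \<alpha> * \<beta> * exp (- \<alpha> * (1 / x powr \<beta> - 1)) / x powr (1 + \<beta>)
      else 0)"

definition unit_gompertz_distributed ::
    "'a measure \<Rightarrow> ('a \<Rightarrow> real) \<Rightarrow> real \<Rightarrow> real \<Rightarrow> bool" where
  "unit_gompertz_distributed M X \<alpha> \<beta> \<longleftrightarrow>
     distributed M lborel X (\<lambda>x. ennreal (unit_gompertz_density \<alpha> \<beta> x))"

definition reversed_hazard_rate :: "(real \<Rightarrow> real) \<Rightarrow> (real \<Rightarrow> real) \<Rightarrow> real \<Rightarrow> real" where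
  "reversed_hazard_rate f F x = f x / F x"

text \<open>The conditional expectation given the event \<open>X \<le> x\<close> is the integral with respect to
  the conditional probability measure, which is \<^const>\<open>uniform_measure\<close> in the library.  For an
  event of probability zero this measure, and hence the value below, is not meaningful; for
  the unit-Gompertz distribution the event has positive probability for every \<open>x > 0\<close>.\<close>

definition expected_inactivity_time :: "'a measure \<Rightarrow> ('a \<Rightarrow> real) \<Rightarrow> real \<Rightarrow> real" where
  "expected_inactivity_time M X x =
     (LINT \<omega>|uniform_measure M {\<omega> \<in> space M. X \<omega> \<le> x}. x - X \<omega>)"

end

theory Submission
  imports Defs
begin

text \<open>The reversed hazard rate is \<open>\<alpha> \<beta> / x powr (1 + \<beta>)\<close>, so its monotonicity is immediate.
  Substituting \<open>y = x t\<close> turns the expected inactivity time into \<open>x\<close> times the integral of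
  \<open>F (x t) / F x\<close> over \<open>t \<in> {0..1}\<close>. The integrand increases with \<open>x\<close> for each \<open>t\<close>, and the factor \<open>x\<close>
  makes the monotonicity strict.\<close>

text \<open>For \<open>0 \<le> X \<omega> \<le> x\<close> the number \<open>x - X \<omega>\<close>
  is the length of \<open>{X \<omega>..x}\<close>, that is, the integral over \<open>y\<close> in
  \<open>{0..x}\<close> of the indicator of \<open>X \<omega> \<le> y\<close>. Tonelli exchanges the
  two integrations, and the inner one becomes the probability of \<open>X \<le> y\<close>. Dividing
  by the probability of the conditioning event gives the claim.\<close>

lemma (in prob_space) expected_inactivity_time_eq_cdf_integral:
  assumes X [measurable]: "X \<in> borel_measurable M"
    and nonneg: "AE \<omega> in M. 0 \<le> X \<omega>"
    and pos: "0 < cdf (distr M borel X) x"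
  shows "expected_inactivity_time M X x =
    1 / cdf (distr M borel X) x * (LBINT y:{0..x}. cdf (distr M borel X) y)"
proof -
  define F where "F = cdf (distr M borel X)"
  define A where "A = {\<omega> \<in> space M. X \<omega> \<le> x}"
  have A [measurable]: "A \<in> sets M"
    unfolding A_def by measurable
  have em: "emeasure M {\<omega> \<in> space M. X \<omega> \<le> y} = ennreal (F y)" for y
    unfolding F_def cdf_def by (subst measure_distr)
      (auto simp: emeasure_eq_measure vimage_def Int_def intro!: arg_cong[where f = prob])
  have F_nonneg: "0 \<le> F y" for y
    unfolding F_def cdf_def by simp
  have "mono F"
    unfolding F_def cdf_def mono_def
    by (auto simp: measure_distr intro!: finite_measure_mono)
  then have F_meas [measurable]: "F \<in> borel_measurable borel"
    by (rule borel_measurable_mono)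
  interpret P: pair_sigma_finite M lborel ..
  have "(\<integral>\<^sup>+\<omega>. ennreal (x - X \<omega>) * indicator A \<omega> \<partial>M) =
      (\<integral>\<^sup>+\<omega>. (\<integral>\<^sup>+y. indicator {0..x} y * indicator {..y} (X \<omega>) \<partial>lborel) \<partial>M)"
  \<comment> \<open>Nonnegativity of \<open>X\<close> makes
    \<open>X \<omega> \<le> y \<le> x\<close> already imply \<open>0 \<le> y\<close>. Outside
    \<open>A\<close> the interval \<open>{X \<omega>..x}\<close> is empty and both sides are
    0.\<close>
  proof (rule nn_integral_cong_AE, use nonneg AE_space in eventually_elim)
    fix \<omega> assume "0 \<le> X \<omega>" "\<omega> \<in> space M"
    then have "(\<integral>\<^sup>+y. indicator {0..x} y * indicator {..y} (X \<omega>) \<partial>lborel) =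
        (\<integral>\<^sup>+y. indicator {X \<omega>..x} y \<partial>lborel)"
      by (intro nn_integral_cong) (auto simp: indicator_def)
    also have "\<dots> = emeasure lborel {X \<omega>..x}"
      by simp
    finally have "(\<integral>\<^sup>+y. indicator {0..x} y * indicator {..y} (X \<omega>) \<partial>lborel) =
      emeasure lborel {X \<omega>..x}" .
    with \<open>\<omega> \<in> space M\<close> show "ennreal (x - X \<omega>) * indicator A \<omega> =
        (\<integral>\<^sup>+y. indicator {0..x} y * indicator {..y} (X \<omega>) \<partial>lborel)"
      by (cases "X \<omega> \<le> x") (simp_all add: A_def)
  qed
  also have "\<dots> = (\<integral>\<^sup>+y. (\<integral>\<^sup>+\<omega>. indicator {0..x} y * indicator {..y} (X \<omega>) \<partial>M) \<partial>lborel)"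
    by (rule P.Fubini'[symmetric]) (simp add: indicator_def case_prod_beta, measurable)
  also have "\<dots> = (\<integral>\<^sup>+y. ennreal (indicator {0..x} y * F y) \<partial>lborel)"
  proof (rule nn_integral_cong)
    fix y
    have "(\<integral>\<^sup>+\<omega>. indicator {0..x} y * indicator {..y} (X \<omega>) \<partial>M) =
        indicator {0..x} y * (\<integral>\<^sup>+\<omega>. indicator {\<omega> \<in> space M. X \<omega> \<le> y} \<omega> \<partial>M)"
      by (subst nn_integral_cmult[symmetric], measurable)
        (auto simp: indicator_def intro!: nn_integral_cong)
    also have "(\<integral>\<^sup>+\<omega>. indicator {\<omega> \<in> space M. X \<omega> \<le> y} \<omega> \<partial>M) = ennreal (F y)"
      unfolding em[symmetric] by (rule nn_integral_indicator) measurable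
    finally show "(\<integral>\<^sup>+\<omega>. indicator {0..x} y * indicator {..y} (X \<omega>) \<partial>M) =
        ennreal (indicator {0..x} y * F y)"
      by (simp add: indicator_def)
  qed
  finally have num: "(\<integral>\<^sup>+\<omega>. ennreal (x - X \<omega>) * indicator A \<omega> \<partial>M) =
    (\<integral>\<^sup>+y. ennreal (indicator {0..x} y * F y) \<partial>lborel)" .
  \<comment> \<open>The conditional measure is concentrated on \<open>A\<close>, where
    \<open>x - X \<omega>\<close> is nonnegative, so the Bochner integral is the real value of a
    nonnegative integral.\<close>
  have "expected_inactivity_time M X x =
      enn2real (\<integral>\<^sup>+\<omega>. ennreal (x - X \<omega>) \<partial>uniform_measure M A)"
    unfolding expected_inactivity_time_def A_def[symmetric]
    by (rule integral_eq_nn_integral)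
      (simp add: uniform_measure_def, auto intro!: AE_uniform_measureI, simp add: A_def)
  also have "\<dots> = enn2real ((\<integral>\<^sup>+y. ennreal (indicator {0..x} y * F y) \<partial>lborel) / ennreal (F x))"
    by (subst nn_integral_uniform_measure) (simp_all add: num em[symmetric] A_def[symmetric])
  also have "\<dots> = enn2real (\<integral>\<^sup>+y. ennreal (indicator {0..x} y * F y) \<partial>lborel) / F x"
    using pos by (simp add: divide_ennreal_def inverse_ennreal enn2real_mult F_def divide_inverse)
  also have "enn2real (\<integral>\<^sup>+y. ennreal (indicator {0..x} y * F y) \<partial>lborel) = (LBINT y:{0..x}. F y)"
    unfolding set_lebesgue_integral_def
    by (subst integral_eq_nn_integral) (auto simp: F_nonneg)
  finally show ?thesis
    by (simp add: F_def)
qed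

text \<open>The derivative is taken at every positive \<open>x\<close>, so that the closed interval
  \<open>{x..1}\<close>, including the end of the support, is covered when the density is
  integrated.\<close>

lemma DERIV_unit_gompertz_cdf:
  assumes "0 < x" "0 < \<beta>"
  shows "((\<lambda>x. exp (- \<alpha> * (1 / x powr \<beta> - 1))) has_real_derivative
    \<alpha> * \<beta> * exp (- \<alpha> * (1 / x powr \<beta> - 1)) / x powr (1 + \<beta>)) (at x)"
  using assms
  by (auto intro!: derivative_eq_intros simp: powr_add powr_diff field_simps)

text \<open>The upper tail is computed first: on \<open>{x..1}\<close> the fundamental theorem of
  calculus applies away from the singularity of the formula at 0. The antiderivative is 1 at the
  right end, and taking the complement leaves its value at \<open>x\<close>.\<close>

lemma cdf_unit_gompertz:
  assumes "prob_space M" and pos: "0 < \<alpha>" "0 < \<beta>"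
    and X: "unit_gompertz_distributed M X \<alpha> \<beta>"
    and x: "0 < x" "x < 1"
  shows "cdf (distr M borel X) x = exp (- \<alpha> * (1 / x powr \<beta> - 1))"
proof -
  interpret prob_space M by fact
  let ?g = "\<lambda>x. \<alpha> * \<beta> * exp (- \<alpha> * (1 / x powr \<beta> - 1)) / x powr (1 + \<beta>)"
  let ?G = "\<lambda>x. exp (- \<alpha> * (1 / x powr \<beta> - 1))"
  have D: "distributed M lborel X (\<lambda>x. ennreal (unit_gompertz_density \<alpha> \<beta> x))"
    using X by (simp add: unit_gompertz_distributed_def)
  have [measurable]: "X \<in> borel_measurable M"
    using distributed_measurable[OF D] by simp
  have "?G x \<le> ?G 1"
    using pos x powr_le1[of \<beta> x] by simp
  have "emeasure M (X -` {x<..} \<inter> space M) =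
      (\<integral>\<^sup>+y. ennreal (unit_gompertz_density \<alpha> \<beta> y) * indicator {x<..} y \<partial>lborel)"
    using D by (rule distributed_emeasure) simp
  \<comment> \<open>The two integrands can differ only at the points \<open>x\<close> and 1, which
    are null sets.\<close>
  also have "\<dots> = (\<integral>\<^sup>+y. ennreal (?g y) * indicator {x..1} y \<partial>lborel)"
    using AE_lborel_singleton[of x] AE_lborel_singleton[of 1] x
    by (intro nn_integral_cong_AE)
      (auto simp: unit_gompertz_density_def indicator_def elim!: eventually_elim2)
  also have "\<dots> = ennreal (?G 1 - ?G x)"
    using pos x by (intro nn_integral_FTC_Icc)
      (auto intro!: DERIV_unit_gompertz_cdf[simplified])
  finally have "prob (X -` {x<..} \<inter> space M) = 1 - ?G x"
    using \<open>?G x \<le> ?G 1\<close> by (simp add: emeasure_eq_measure)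
  moreover have "prob (X -` {..x} \<inter> space M) = 1 - prob (X -` {x<..} \<inter> space M)"
    by (subst prob_compl[symmetric]) (auto intro!: arg_cong[where f = prob])
  ultimately show ?thesis
    by (simp add: cdf_def measure_distr)
qed

lemma AE_unit_gompertz_pos:
  assumes "unit_gompertz_distributed M X \<alpha> \<beta>"
  shows "AE \<omega> in M. 0 < X \<omega>"
proof -
  have D: "distributed M lborel X (\<lambda>x. ennreal (unit_gompertz_density \<alpha> \<beta> x))"
    using assms by (simp add: unit_gompertz_distributed_def)
  have "AE x in distr M lborel X. 0 < x"
    unfolding distributed_distr_eq_density[OF D]
    by (subst AE_density) (use distributed_borel_measurable[OF D] in
      \<open>auto simp: unit_gompertz_density_def\<close>)
  then show ?thesis
    using distributed_measurable[OF D] by (simp add: AE_distr_iff)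
qed

theorem theorem5p1:
  fixes M :: "'a measure" and X :: "'a \<Rightarrow> real" and \<alpha> \<beta> :: real
    and f F :: "real \<Rightarrow> real"
  assumes "prob_space M"
    and "\<alpha> > 0" and "\<beta> > 0"
    and "unit_gompertz_distributed M X \<alpha> \<beta>"
    and "f = unit_gompertz_density \<alpha> \<beta>"
    and "F = cdf (distr M borel X)"
  shows "strict_antimono_on {0<..<1} (reversed_hazard_rate f F) \<and>
    (\<forall>x\<in>{0<..<1}. expected_inactivity_time M X x = 1 / F x * (LBINT y:{0..x}. F y)) \<and>
    strict_mono_on {0<..<1} (expected_inactivity_time M X)"
proof -
  interpret prob_space M by fact
  have X [measurable]: "X \<in> borel_measurable M"
    using assms(4) unfolding unit_gompertz_distributed_def
    by (auto dest: distributed_measurable)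
  interpret N: real_distribution "distr M borel X"
    by (rule real_distribution_distr) simp
  have F_eq: "F x = exp (- \<alpha> * (1 / x powr \<beta> - 1))" if "0 < x" "x < 1" for x
    using cdf_unit_gompertz[OF assms(1-4) that] assms(6) by simp
  have F_pos: "0 < F x" if "0 < x" "x < 1" for x
    using F_eq that by simp
  have F_nonneg: "0 \<le> F x" for x
    by (simp add: assms(6) N.cdf_nonneg)
  have F_mono: "x \<le> y \<Longrightarrow> F x \<le> F y" for x y
    by (simp add: assms(6) N.cdf_nondecreasing)
  have F_le1: "F x \<le> 1" for x
    by (simp add: assms(6) N.cdf_bounded_prob)
  have F_meas [measurable]: "F \<in> borel_measurable borel"
    by (intro borel_measurable_mono monoI F_mono)
  \<comment> \<open>The closed form \<open>F_eq\<close> holds only inside the unit interval, but the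
    rescaled integrand is also evaluated at \<open>t = 0\<close>. There the value comes from
    \<open>X\<close> being positive almost surely.\<close>
  have F0: "F 0 = 0"
  proof -
    have "AE \<omega> in M. \<omega> \<notin> X -` {..0} \<inter> space M"
      using AE_unit_gompertz_pos[OF assms(4)] by eventually_elim auto
    then have "prob (X -` {..0} \<inter> space M) = 0"
      by (subst prob_eq_0) auto
    then show ?thesis
      by (simp add: assms(6) cdf_def measure_distr)
  qed
  have rhr: "reversed_hazard_rate f F x = \<alpha> * \<beta> / x powr (1 + \<beta>)" if "0 < x" "x < 1" for x
    using that F_eq[OF that]
    by (simp add: reversed_hazard_rate_def assms(5) unit_gompertz_density_def)
  have anti: "strict_antimono_on {0<..<1} (reversed_hazard_rate f F)"
    using assms(2,3)
    by (auto intro!: monotone_onI divide_strict_left_mono powr_less_mono2 simp: rhr)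
  have X_nonneg: "AE \<omega> in M. 0 \<le> X \<omega>"
    using AE_unit_gompertz_pos[OF assms(4)] by eventually_elim simp
  have eit: "expected_inactivity_time M X x = 1 / F x * (LBINT y:{0..x}. F y)"
    if "0 < x" "x < 1" for x
    using expected_inactivity_time_eq_cdf_integral[OF X X_nonneg, of x] F_pos[OF that]
    by (simp add: assms(6))
  define J where "J x = (LBINT t:{0..1}. F (x * t) / F x)" for x
  \<comment> \<open>The integrand is bounded by \<open>1 / F x\<close> on an interval of finite
    length.\<close>
  have integrable: "set_integrable lborel {0..1} (\<lambda>t. F (x * t) / F x)" if "0 < x" "x < 1" for x
    unfolding set_integrable_def
    using F_nonneg F_le1 F_pos[OF that]
    by (intro integrableI_bounded_set_indicator[where B = "1 / F x"])
      (auto intro!: AE_I2 divide_right_mono)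
  have eit_J: "expected_inactivity_time M X x = x * J x" if "0 < x" "x < 1" for x
  proof -
    have "(LBINT y:{0..x}. F y) = \<bar>x\<bar> *\<^sub>R (LBINT t. indicator {0..x} (0 + x * t) *\<^sub>R F (0 + x * t))"
      unfolding set_lebesgue_integral_def
      using that by (intro lborel_integral_real_affine) simp
    also have "\<dots> = x * (LBINT t:{0..1}. F (x * t))"
      using that unfolding set_lebesgue_integral_def
      by (auto simp: indicator_def mult_le_cancel_left1 zero_le_mult_iff
        intro!: Bochner_Integration.integral_cong)
    finally show ?thesis
      by (simp add: eit[OF that] J_def)
  qed
  \<comment> \<open>Restricting to \<open>{1/2..1}\<close> keeps \<open>t\<close> away from 0: there
    \<open>F (x * t)\<close> is at least \<open>F (x / 2)\<close>, which is positive.\<close>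
  have J_pos: "0 < J x" if x: "0 < x" "x < 1" for x
  proof -
    have "0 < F (x / 2) / F x * (1 / 2)"
      using F_pos[OF x] F_pos[of "x / 2"] x by simp
    also have "\<dots> = (LBINT t:{1/2..1::real}. F (x / 2) / F x)"
      by (simp add: set_lebesgue_integral_def)
    also have "\<dots> \<le> (LBINT t:{1/2..1}. F (x * t) / F x)"
    proof (rule set_integral_mono)
      show "set_integrable lborel {1/2..1} (\<lambda>t. F (x * t) / F x)"
        using integrable[OF x] by (rule set_integrable_subset) auto
    qed (use x F_pos[OF x] in
        \<open>auto intro!: borel_integrable_atLeastAtMost' divide_right_mono F_mono\<close>)
    also have "\<dots> \<le> J x"
      using integrable[OF x] set_integrable_subset[OF integrable[OF x], of "{1/2..1}"]
      unfolding J_def set_lebesgue_integral_def set_integrable_def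
      by (intro integral_mono) (auto simp: indicator_def F_nonneg)
    finally show ?thesis .
  qed
  have ratio: "F (x * t) / F x \<le> F (y * t) / F y"
    if "0 < x" "x < y" "y < 1" "0 \<le> t" "t \<le> 1" for x y t
  proof (cases "t = 0")
    case False
    \<comment> \<open>In the quotient the constants in the exponents cancel and \<open>z\<close>
      survives only in the factor \<open>1 / z powr \<beta>\<close>, which decreases in
      \<open>z\<close>. Its coefficient is nonnegative because \<open>t \<le> 1\<close>, so the
      quotient grows with \<open>z\<close>.\<close>
    have *: "F (z * t) / F z = exp (- (\<alpha> * (1 / t powr \<beta> - 1) / z powr \<beta>))"
      if z: "0 < z" "z < 1" for z
    proof -
      have "z * t < 1"
        using z \<open>t \<le> 1\<close> mult_left_le[of t z] by linarith
      then show ?thesis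
        using z False \<open>0 \<le> t\<close>
        by (simp add: F_eq exp_diff[symmetric] powr_mult field_simps)
    qed
    have "0 \<le> \<alpha> * (1 / t powr \<beta> - 1)"
      using assms(2,3) False that powr_le1[of \<beta> t] by simp
    then show ?thesis
      using that assms(3)
      by (auto simp: * intro!: divide_left_mono powr_mono2)
  qed (simp add: F0)
  have mono: "strict_mono_on {0<..<1} (expected_inactivity_time M X)"
  proof (rule monotone_onI)
    fix x y :: real
    assume xy: "x \<in> {0<..<1}" "y \<in> {0<..<1}" "x < y"
    then have "J x \<le> J y"
      unfolding J_def by (intro set_integral_mono integrable ratio) auto
    \<comment> \<open>Strictness comes from \<open>x < y\<close> alone, since \<open>J\<close> is
      only known to be weakly increasing; positivity of \<open>J x\<close> carries it over to the
      product.\<close>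
    then have "x * J x < y * J y"
      using xy J_pos[of x] by (intro mult_less_le_imp_less) auto
    then show "expected_inactivity_time M X x < expected_inactivity_time M X y"
      using xy by (simp add: eit_J)
  qed
  show ?thesis
    using anti eit mono by auto
qed

end
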